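(* Let $G$ be a directed graph without multiedges, $s,t$ nodes of $G$, and $B$ its $s$-$t$ bridge sequence. A substring $L$ of $B$ is safe under the $s$-$t$ trails model if and only if $L$ has no trail breaker, i.e. there is no pair of consecutive edges $e_i,e_{i+1}$ of $L$ together with a non-empty path from $\mathrm{head}(e_i)$ to $\mathrm{tail}(e_{i+1})$ that uses neither $e_i$ nor $e_{i+1}$.
   Context: An $s$-$t$ bridge is an edge whose removal leaves no $s$-$t$ path; all $s$-$t$ bridges appear on every $s$-$t$ path in the same order, and $B$ is the sequence of $s$-$t$ bridges in this order. For an edge $e=(u,v)$, $\mathrm{tail}(e)=u$, $\mathrm{head}(e)=v$. A trail is a walk repeating no edge (nodes may repeat). A sequence of edges is safe under the $s$-$t$ trails model if it is a substring (contiguous) of the edge sequence of every $s$-$t$ trail of $G$. A path from a node to itself (when $\mathrm{head}(e_i)=\mathrm{tail}(e_{i+1})$) is a cycle. *)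

theory Defs
  imports "Graph_Theory.Graph_Theory" "HOL-Library.Sublist"
begin

context pre_digraph
begin

definition st_bridge :: "'a \<Rightarrow> 'a \<Rightarrow> 'b \<Rightarrow> bool" where
  "st_bridge s t e \<longleftrightarrow> e \<in> arcs G \<and> \<not> (\<exists>p. pre_digraph.apath (del_arc e) s p t)"

text \<open>
  The description is well defined as soon as \<open>G\<close> has an \<open>s\<close>-\<open>t\<close> path,
  see \<open>ex1_bridge_seq\<close> below. Otherwise every arc is an \<open>s\<close>-\<open>t\<close> bridge and the order is
  not determined.
\<close>
definition bridge_seq :: "'a \<Rightarrow> 'a \<Rightarrow> 'b list" where
  "bridge_seq s t = (THE B. distinct B \<and> set B = {e. st_bridge s t e} \<and>
     (\<forall>p. apath s p t \<longrightarrow> subseq B p))"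

text \<open>Contiguity is expressed by \<^const>\<open>sublist\<close>; \<^const>\<open>subseq\<close> allows gaps.\<close>
definition trail_safe :: "'a \<Rightarrow> 'a \<Rightarrow> 'b list \<Rightarrow> bool" where
  "trail_safe s t L \<longleftrightarrow> (\<forall>p. trail s p t \<longrightarrow> sublist L p)"

text \<open>
  The only \<^const>\<open>apath\<close> from a node to itself is empty, so cycles (loops included)
  are added explicitly.
\<close>
definition path_or_cycle :: "'a \<Rightarrow> 'b list \<Rightarrow> 'a \<Rightarrow> bool" where
  "path_or_cycle u p v \<longleftrightarrow> apath u p v \<or> (u = v \<and> awalk u p v \<and> cycle p)"

definition has_trail_breaker :: "'b list \<Rightarrow> bool" where
  "has_trail_breaker L \<longleftrightarrow>
     (\<exists>i p. Suc i < length L \<and> p \<noteq> [] \<and>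
        path_or_cycle (head G (L ! i)) p (tail G (L ! Suc i)) \<and>
        L ! i \<notin> set p \<and> L ! Suc i \<notin> set p)"

end

lemma distinct_eq_if_same_order:
  assumes "distinct xs" "distinct ys" "set xs = set ys"
    and "\<And>e f. subseq [e, f] xs \<Longrightarrow> subseq [f, e] ys \<Longrightarrow> False"
  shows "xs = ys"
  using assms
proof (induction xs arbitrary: ys)
  case Nil
  then show ?case by simp
next
  case (Cons x xs)
  then obtain y ys' where ys: "ys = y # ys'" by (cases ys) auto
  have "x = y"
  proof (rule ccontr)
    assume "x \<noteq> y"
    then have "y \<in> set xs" "x \<in> set ys'" using Cons.prems(3) ys by auto
    then have "subseq [x, y] (x # xs)" "subseq [y, x] ys"
      using ys by (auto simp: subseq_singleton_left)
    then show False using Cons.prems(4) by blast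
  qed
  moreover have "xs = ys'"
  proof (rule Cons.IH)
    show "distinct xs" "distinct ys'" using Cons.prems ys by auto
    show "set xs = set ys'" using Cons.prems(1-3) ys \<open>x = y\<close> by (auto simp: insert_eq_iff)
    show "False" if "subseq [e, f] xs" "subseq [f, e] ys'" for e f
      using Cons.prems(4)[of e f] that ys list_emb_Cons by metis
  qed
  ultimately show ?case using ys by simp
qed

lemma subseq_pairE:
  assumes "subseq [e, f] p"
  obtains p1 p2 p3 where "p = p1 @ e # p2 @ f # p3"
proof -
  from list_emb_ConsD[OF assms] obtain us v vs
    where "p = us @ v # vs" "e = v" "subseq [f] vs" by blast
  moreover from this obtain vs1 vs2 where "vs = vs1 @ f # vs2"
    using subseq_singleton_left by (metis split_list)
  ultimately show thesis using that by blast
qed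

context wf_digraph
begin

lemma awalk_del_arc:
  assumes "awalk u p v" "e \<notin> set p"
  shows "pre_digraph.awalk (del_arc e) u p v"
proof -
  have "pre_digraph.cas (del_arc e) u p v = cas u p v" for u
    by (induction p arbitrary: u) (simp_all add: pre_digraph.cas.simps)
  then show ?thesis using assms unfolding pre_digraph.awalk_def by auto
qed

lemma st_bridge_in_awalk:
  assumes "st_bridge s t e" "awalk s p t"
  shows "e \<in> set p"
proof (rule ccontr)
  assume "e \<notin> set p"
  interpret D: wf_digraph "del_arc e" by (rule wf_digraph_del_arc)
  from \<open>e \<notin> set p\<close> assms(2) have "D.awalk s p t" by (rule awalk_del_arc[rotated])
  then show False using D.apath_awalk_to_apath assms(1) unfolding st_bridge_def by blast
qed

lemma st_bridge_same_order:
  assumes "st_bridge s t e" "apath s p t" "apath s q t"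
    and "subseq [e, f] p" "subseq [f, e] q"
  shows False
proof -
  obtain p1 p2 p3 where p: "p = p1 @ e # p2 @ f # p3"
    using assms(4) by (rule subseq_pairE)
  obtain q1 q2 q3 where q: "q = q1 @ f # q2 @ e # q3"
    using assms(5) by (rule subseq_pairE)
  have wp: "awalk s p t" "distinct p" and wq: "awalk s q t" "distinct q"
    using assms(2,3) distinct_verts_imp_distinct by (auto simp: apath_def)
  have "awalk s (q1 @ [f]) (head G f)" "awalk (head G f) p3 t"
    using wp(1) wq(1) by (auto simp: p q awalk_simps)
  then have "awalk s ((q1 @ [f]) @ p3) t" by (rule awalk_appendI)
  then have "e \<in> set ((q1 @ [f]) @ p3)" by (rule st_bridge_in_awalk[OF assms(1)])
  then show False using wp(2) wq(2) by (auto simp: p q)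
qed

lemma ex1_bridge_seq:
  assumes "\<exists>p. apath s p t"
  shows "\<exists>!B. distinct B \<and> set B = {e. st_bridge s t e} \<and> (\<forall>p. apath s p t \<longrightarrow> subseq B p)"
proof -
  obtain p where p: "apath s p t" using assms by blast
  have dist: "distinct q" if "apath s q t" for q
    using that distinct_verts_imp_distinct by (auto simp: apath_def)
  let ?F = "filter (st_bridge s t)"
  have set_F: "set (?F q) = {e. st_bridge s t e}" if "apath s q t" for q
    using st_bridge_in_awalk awalkI_apath[OF that] by auto
  have F_eq: "?F p = ?F q" if q: "apath s q t" for q
  proof (rule distinct_eq_if_same_order)
    show "distinct (?F p)" "distinct (?F q)" using dist p q by auto
    show "set (?F p) = set (?F q)" using set_F p q by simp
    fix e f assume sub: "subseq [e, f] (?F p)" "subseq [f, e] (?F q)"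
    have "e \<in> set (?F p)" using subseq_pairE[OF sub(1)] by (metis in_set_conv_decomp)
    then have "st_bridge s t e" by simp
    moreover have "subseq [e, f] p" "subseq [f, e] q"
      using sub subseq_filter_left subseq_order.trans by blast+
    ultimately show False using st_bridge_same_order p q by blast
  qed
  show ?thesis
  proof (rule ex1I[of _ "?F p"], intro conjI allI impI)
    show "distinct (?F p)" using dist p by simp
    show "set (?F p) = {e. st_bridge s t e}" using set_F p by blast
    show "subseq (?F p) q" if "apath s q t" for q
      using F_eq[OF that] by simp
  next
    fix B assume B: "distinct B \<and> set B = {e. st_bridge s t e} \<and> (\<forall>p. apath s p t \<longrightarrow> subseq B p)"
    show "B = ?F p"
    proof (rule distinct_eq_if_same_order)
      show "distinct B" "distinct (?F p)" "set B = set (?F p)" using B dist set_F p by auto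
      fix e f assume sub: "subseq [e, f] B" "subseq [f, e] (?F p)"
      have "e \<in> set B" using subseq_pairE[OF sub(1)] by (metis in_set_conv_decomp)
      then have "st_bridge s t e" using B by auto
      moreover have "subseq [e, f] p" "subseq [f, e] p"
        using sub B p subseq_filter_left subseq_order.trans by blast+
      ultimately show False using st_bridge_same_order p by blast
    qed
  qed
qed

lemmas bridge_seq_props = theI'[OF ex1_bridge_seq, folded bridge_seq_def]

end

end

theory Submission
  imports Defs
begin

text \<open>
  Bridges occur in the same order on every \<open>s\<close>-\<open>t\<close> trail, so a trail avoiding \<open>L\<close> as a substring
  inserts a non-empty detour between two consecutive bridges of \<open>L\<close>, and such a detour contains a
  path or cycle. Conversely, let \<open>c\<close> be a breaker between \<open>e\<close> and \<open>f\<close>. If some \<open>s\<close>-\<open>t\<close> path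
  does not traverse \<open>e\<close> and \<open>f\<close> consecutively, it witnesses unsafety. Otherwise \<open>c\<close> is a cycle
  that can be spliced into an \<open>s\<close>-\<open>t\<close> path between \<open>e\<close> and \<open>f\<close>: an arc shared by \<open>c\<close> with the part
  of the path before \<open>e\<close> (after \<open>f\<close>) would give a shortcut bypassing the bridge \<open>e\<close> (\<open>f\<close>).
\<close>

lemma sublist_if_consecutive_sublists:
  assumes "distinct p" "set L \<subseteq> set p"
    and "\<And>i. Suc i < length L \<Longrightarrow> sublist [L ! i, L ! Suc i] p"
  shows "sublist L p"
  using assms(2,3)
proof (induction L rule: induct_list012)
  case 1
  then show ?case by simp
next
  case (2 x)
  then show ?case by (auto simp: sublist_def dest: split_list)
next
  case (3 x y L)
  have "sublist [(y # L) ! i, (y # L) ! Suc i] p" if "Suc i < length (y # L)" for i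
    using "3.prems"(2)[of "Suc i"] that by simp
  then have "sublist (y # L) p" using "3.IH"(2) "3.prems"(1) by simp
  then obtain a b where p: "p = a @ y # L @ b" by (auto simp: sublist_def)
  have "sublist [x, y] p" using "3.prems"(2)[of 0] by simp
  then obtain c d where p': "p = (c @ [x]) @ y # d" by (auto simp: sublist_def)
  have "c @ [x] = a \<and> d = L @ b"
    using p p' \<open>distinct p\<close> append_Cons_eq_iff[of y a "L @ b" "c @ [x]" d] by simp
  then have "p = c @ (x # y # L) @ b" using p by simp
  then show ?case unfolding sublist_def by blast
qed

lemma not_sublist_pair_if_gap:
  assumes "distinct (p @ e # r @ f # q)" "r \<noteq> []"
  shows "\<not> sublist [e, f] (p @ e # r @ f # q)"
proof
  assume "sublist [e, f] (p @ e # r @ f # q)"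
  then obtain a b where eq: "p @ e # r @ f # q = a @ e # f # b" by (auto simp: sublist_def)
  moreover have "e \<notin> set p" "e \<notin> set (r @ f # q)" using assms(1) by auto
  ultimately have "p = a \<and> r @ f # q = f # b"
    using append_Cons_eq_iff[of e p "r @ f # q" a "f # b"] by simp
  then show False using assms by (cases r) auto
qed

lemma sublist_nth_Suc:
  assumes "Suc i < length L"
  shows "sublist [L ! i, L ! Suc i] L"
proof -
  have "L = take i L @ [L ! i, L ! Suc i] @ drop (Suc (Suc i)) L"
    using assms by (simp add: Cons_nth_drop_Suc)
  then show ?thesis unfolding sublist_def by blast
qed

context wf_digraph
begin

lemma path_or_cycle_of_awalk:
  assumes "awalk u r v" "r \<noteq> []"
  obtains c where "path_or_cycle u c v" "c \<noteq> []" "set c \<subseteq> set r"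
proof (cases "u = v")
  case False
  have "apath u (awalk_to_apath r) v" "set (awalk_to_apath r) \<subseteq> set r"
    using assms(1) by (auto intro: apath_awalk_to_apath dest: awalk_to_apath_subset)
  moreover from this False have "awalk_to_apath r \<noteq> []" by (auto simp: apath_def awalk_simps)
  ultimately show thesis using that by (auto simp: path_or_cycle_def)
next
  case True
  obtain a r' where r: "r = a # r'" using assms(2) by (cases r) auto
  let ?q = "awalk_to_apath r'"
  have a: "a \<in> arcs G" "tail G a = u" and r': "awalk (head G a) r' v"
    using assms(1) by (auto simp: r awalk_Cons_iff)
  have q: "apath (head G a) ?q v" "set ?q \<subseteq> set r'"
    using r' by (auto intro: apath_awalk_to_apath dest: awalk_to_apath_subset)
  then have walk: "awalk u (a # ?q) v" using a by (auto simp: awalk_Cons_iff apath_def)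
  moreover have "distinct (tl (awalk_verts u (a # ?q)))" using q(1) by (simp add: apath_def)
  ultimately have "cycle (a # ?q)" using True by (auto simp: cycle_def)
  then show thesis using that[of "a # ?q"] walk True q(2) by (auto simp: path_or_cycle_def r)
qed

lemma st_bridge_same_order_trail:
  assumes "st_bridge s t e" "trail s p t" "trail s q t"
    and "subseq [e, f] p" "subseq [f, e] q"
  shows False
proof -
  obtain p1 p2 p3 where p: "p = p1 @ e # p2 @ f # p3"
    using assms(4) by (rule subseq_pairE)
  obtain q1 q2 q3 where q: "q = q1 @ f # q2 @ e # q3"
    using assms(5) by (rule subseq_pairE)
  have "awalk s (q1 @ [f]) (head G f)" "awalk (head G f) p3 t"
    using assms(2,3) by (auto simp: p q trail_def awalk_simps)
  then have "awalk s ((q1 @ [f]) @ p3) t" by (rule awalk_appendI)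
  then have "e \<in> set ((q1 @ [f]) @ p3)" by (rule st_bridge_in_awalk[OF assms(1)])
  then show False using assms(2,3) by (auto simp: p q trail_def)
qed

lemma trail_of_apath: "apath u p v \<Longrightarrow> trail u p v"
  by (auto simp: apath_def trail_def intro: distinct_verts_imp_distinct)

lemma trail_visits_bridges_consecutively:
  assumes "st_bridge s t e" "st_bridge s t f" "e \<noteq> f"
    and "apath s p t" "subseq [e, f] p"
    and no_detour: "\<And>c. path_or_cycle (head G e) c (tail G f) \<Longrightarrow> c \<noteq> [] \<Longrightarrow> e \<in> set c \<or> f \<in> set c"
    and "trail s q t"
  shows "sublist [e, f] q"
proof -
  have "e \<in> set q" "f \<in> set q"
    using st_bridge_in_awalk assms(1,2,7) by (auto simp: trail_def)
  then obtain a b where ab: "q = a @ e # b" and "f \<in> set a \<or> f \<in> set b"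
    using \<open>e \<noteq> f\<close> by (auto dest!: split_list[of e])
  then consider "subseq [e, f] q" | "subseq [f, e] q"
    using list_emb_append_mono[of "(=)" "[f]" a "[e]" "e # b"]
      list_emb_append2[of "(=)" "[e, f]" "e # b" a]
    by (auto simp: ab subseq_singleton_left)
  then show ?thesis
  proof cases
    case 1
    then obtain q1 r q3 where q: "q = q1 @ e # r @ f # q3" by (rule subseq_pairE)
    have r: "awalk (head G e) r (tail G f)" and "distinct q"
      using assms(7) by (auto simp: q trail_def awalk_simps)
    have "r = []"
    proof (rule ccontr)
      assume "r \<noteq> []"
      with r obtain c where "path_or_cycle (head G e) c (tail G f)" "c \<noteq> []" "set c \<subseteq> set r"
        by (rule path_or_cycle_of_awalk)
      then show False using no_detour[of c] \<open>distinct q\<close> by (auto simp: q)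
    qed
    then show ?thesis by (auto simp: q sublist_def)
  next
    case 2
    then show ?thesis
      using st_bridge_same_order_trail[OF assms(1) trail_of_apath[OF assms(4)] assms(7,5)] by simp
  qed
qed

lemma splice_cycle_between_bridges:
  assumes "st_bridge s t e" "st_bridge s t f" "trail s (p @ e # f # q) t"
    and "awalk (head G e) c (tail G f)" "distinct c" "e \<notin> set c" "f \<notin> set c"
  shows "trail s (p @ e # c @ f # q) t"
proof -
  have dist: "distinct (p @ e # f # q)" using assms(3) by (simp add: trail_def)
  have "g \<notin> set p" if "g \<in> set c" for g
  proof
    assume "g \<in> set p"
    then obtain p1 p2 c1 c2 where p: "p = p1 @ g # p2" and c: "c = c1 @ g # c2"
      using \<open>g \<in> set c\<close> by (meson split_list)
    have "awalk s (p1 @ [g]) (head G g)" "awalk (head G g) (c2 @ f # q) t"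
      using assms(3,4) by (auto simp: p c trail_def awalk_simps)
    then have "awalk s ((p1 @ [g]) @ c2 @ f # q) t" by (rule awalk_appendI)
    from st_bridge_in_awalk[OF assms(1) this] show False
      using dist assms(6) by (auto simp: p c)
  qed
  moreover have "g \<notin> set q" if "g \<in> set c" for g
  proof
    assume "g \<in> set q"
    then obtain q1 q2 c1 c2 where q: "q = q1 @ g # q2" and c: "c = c1 @ g # c2"
      using \<open>g \<in> set c\<close> by (meson split_list)
    have "awalk s (p @ e # c1 @ [g]) (head G g)" "awalk (head G g) q2 t"
      using assms(3,4) by (auto simp: q c trail_def awalk_simps)
    then have "awalk s ((p @ e # c1 @ [g]) @ q2) t" by (rule awalk_appendI)
    from st_bridge_in_awalk[OF assms(2) this] show False
      using dist assms(7) by (auto simp: q c)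
  qed
  ultimately have "distinct (p @ e # c @ f # q)" using dist assms(5-7) by auto
  moreover have "awalk s (p @ e # c @ f # q) t"
    using assms(3,4) by (auto simp: trail_def awalk_simps)
  ultimately show ?thesis by (simp add: trail_def)
qed

lemma ex_trail_separating_bridges:
  assumes "st_bridge s t e" "st_bridge s t f" "apath s p t" "subseq [e, f] p"
    and "path_or_cycle (head G e) c (tail G f)" "c \<noteq> []" "e \<notin> set c" "f \<notin> set c"
  obtains q where "trail s q t" "\<not> sublist [e, f] q"
proof -
  obtain p1 r p3 where p: "p = p1 @ e # r @ f # p3" using assms(4) by (rule subseq_pairE)
  have trail: "trail s p t" using assms(3) by (rule trail_of_apath)
  show thesis
  proof (cases "r = []")
    case False
    then show thesis using that[OF trail] trail not_sublist_pair_if_gap[of p1 e r f p3]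
      by (auto simp: p trail_def)
  next
    case True
    have c: "awalk (head G e) c (tail G f)"
      using assms(5) by (auto simp: path_or_cycle_def apath_def)
    have "distinct c"
      using assms(5) by (auto simp: path_or_cycle_def cycle_conv
        intro: distinct_verts_imp_distinct simp: apath_def)
    then have q: "trail s (p1 @ e # c @ f # p3) t"
      using splice_cycle_between_bridges[OF assms(1,2) _ c] trail True assms(7,8) by (simp add: p)
    then show thesis
      using that[OF q] not_sublist_pair_if_gap[of p1 e c f p3] assms(6) by (simp add: trail_def)
  qed
qed

lemma trail_safe_iff_no_trail_breaker:
  assumes "\<exists>p. apath s p t" "sublist L (bridge_seq s t)"
  shows "trail_safe s t L \<longleftrightarrow> \<not> has_trail_breaker L"
proof -
  obtain p where p: "apath s p t" using assms(1) by blast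
  have B: "distinct (bridge_seq s t)" "set (bridge_seq s t) = {e. st_bridge s t e}"
    "subseq (bridge_seq s t) p"
    using bridge_seq_props[OF assms(1)] p by auto
  have L: "distinct L" "\<And>e. e \<in> set L \<Longrightarrow> st_bridge s t e" "subseq L p"
    using assms(2) B set_mono_sublist[OF assms(2)]
      subseq_order.trans[OF sublist_imp_subseq[OF assms(2)]] by (auto simp: sublist_def)
  have pair: "st_bridge s t (L ! i)" "st_bridge s t (L ! Suc i)" "L ! i \<noteq> L ! Suc i"
    "subseq [L ! i, L ! Suc i] p" if "Suc i < length L" for i
    using that L subseq_order.trans[OF sublist_imp_subseq[OF sublist_nth_Suc[OF that]]]
    by (auto simp: nth_eq_iff_index_eq)
  show ?thesis
  proof
    assume safe: "trail_safe s t L"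
    show "\<not> has_trail_breaker L"
    proof
      assume "has_trail_breaker L"
      then obtain i c where i: "Suc i < length L" and c: "c \<noteq> []"
        "path_or_cycle (head G (L ! i)) c (tail G (L ! Suc i))" "L ! i \<notin> set c" "L ! Suc i \<notin> set c"
        unfolding has_trail_breaker_def by blast
      obtain q where q: "trail s q t" "\<not> sublist [L ! i, L ! Suc i] q"
        using ex_trail_separating_bridges[OF pair(1,2)[OF i] p pair(4)[OF i] c(2,1,3,4)] by blast
      then show False
        using safe sublist_order.order.trans[OF sublist_nth_Suc[OF i]] by (auto simp: trail_safe_def)
    qed
  next
    assume no: "\<not> has_trail_breaker L"
    show "trail_safe s t L"
      unfolding trail_safe_def
    proof (intro allI impI)
      fix q assume q: "trail s q t"
      show "sublist L q"
      proof (rule sublist_if_consecutive_sublists)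
        show "distinct q" using q by (simp add: trail_def)
        show "set L \<subseteq> set q" using q L(2) st_bridge_in_awalk unfolding trail_def by blast
        show "sublist [L ! i, L ! Suc i] q" if i: "Suc i < length L" for i
          using trail_visits_bridges_consecutively[OF pair(1-3)[OF i] p pair(4)[OF i] _ q] no i
          unfolding has_trail_breaker_def by blast
      qed
    qed
  qed
qed

end

theorem theorem8:
  fixes G :: "('a, 'b) pre_digraph" and s t :: 'a and L :: "'b list"
  assumes "nomulti_digraph G"
    and "s \<in> verts G" and "t \<in> verts G"
    and "\<exists>p. pre_digraph.apath G s p t"
    and "sublist L (pre_digraph.bridge_seq G s t)"
  shows "pre_digraph.trail_safe G s t L \<longleftrightarrow> \<not> pre_digraph.has_trail_breaker G L"
proof -
  interpret nomulti_digraph G by fact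
  show ?thesis using assms(4,5) by (rule trail_safe_iff_no_trail_breaker)
qed

end
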